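(* Let $V$ be a finite-dimensional vector space over $\mathbb{C}$, and let $E\subseteq \operatorname{End}(V)$ be a linear subspace. If $\operatorname{Ref}_{a}(E)\cap\operatorname{GL}(V)\neq\varnothing$, then $E\cap\operatorname{GL}(V)\neq\varnothing$.
   Context: For $E\subseteq \operatorname{End}(V)$, the algebraic reflexive hull of $E$ is $\operatorname{Ref}_{a}(E)=\{f\in\operatorname{End}(V)\mid f(v)\in E(v)\text{ for all }v\in V\}$, where $E(v):=\{g(v)\mid g\in E\}$. *)

theory Defs
  imports Complex_Main "HOL-Library.Function_Algebras"
begin

text \<open>
  A vector space \<open>V\<close> is a whole type \<open>'v\<close> with a scalar multiplication \<open>s\<close>.
  Addition and zero of functions \<open>'v \<Rightarrow> 'v\<close> are the pointwise ones of
  \<^theory>\<open>HOL-Library.Function_Algebras\<close>.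
\<close>

definition fun_scale :: "('a \<Rightarrow> 'v \<Rightarrow> 'v) \<Rightarrow> 'a \<Rightarrow> ('v \<Rightarrow> 'v) \<Rightarrow> ('v \<Rightarrow> 'v)"
  where "fun_scale s c f = (\<lambda>v. s c (f v))"

definition End :: "('a::field \<Rightarrow> 'v::ab_group_add \<Rightarrow> 'v) \<Rightarrow> ('v \<Rightarrow> 'v) set"
  where "End s = {f. Vector_Spaces.linear s s f}"

definition GL :: "('a::field \<Rightarrow> 'v::ab_group_add \<Rightarrow> 'v) \<Rightarrow> ('v \<Rightarrow> 'v) set"
  where "GL s = {f \<in> End s. bij f}"

definition eval_at :: "('v \<Rightarrow> 'v) set \<Rightarrow> 'v \<Rightarrow> 'v set"
  where "eval_at E v = {g v | g. g \<in> E}"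

definition Ref_a :: "('a::field \<Rightarrow> 'v::ab_group_add \<Rightarrow> 'v) \<Rightarrow> ('v \<Rightarrow> 'v) set \<Rightarrow> ('v \<Rightarrow> 'v) set"
  where "Ref_a s E = {f \<in> End s. \<forall>v. f v \<in> eval_at E v}"

lemma vector_space_fun_scale:
  assumes "vector_space s"
  shows "vector_space (fun_scale s)"
proof -
  interpret vector_space s by fact
  show ?thesis
    by unfold_locales
      (auto simp: fun_scale_def fun_eq_iff plus_fun_def scale_right_distrib scale_left_distrib)
qed

lemma subspace_End:
  assumes "vector_space s"
  shows "module.subspace (fun_scale s) (End s)"
proof -
  interpret V: vector_space s by fact
  interpret F: vector_space "fun_scale s" by (rule vector_space_fun_scale) fact
  show ?thesis
    unfolding F.subspace_def End_def
    by (auto simp: Vector_Spaces.linear_iff fun_scale_def V.vector_space_axioms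
        V.scale_right_distrib V.scale_left_commute algebra_simps)
qed

end

theory Submission
  imports Defs "Jordan_Normal_Form.Char_Poly"
begin

text \<open>
  Composing with the inverse of an invertible element of the reflexive hull, we may assume that for
  every \<open>v\<close> some \<open>g \<in> E\<close> satisfies \<open>g v = v\<close>. Suppose every element of \<open>E\<close> is singular, and let \<open>m\<close> be the
  least index such that the \<open>m\<close>-th coefficient of the characteristic polynomial does not vanish
  identically on \<open>E\<close>, say not at \<open>h\<close>. Take \<open>v \<noteq> 0\<close> with \<open>h v = 0\<close> and \<open>h' \<in> E\<close> with \<open>h' v = v\<close>. Then \<open>h + t h'\<close>
  has eigenvalue \<open>t\<close>, while its characteristic polynomial is \<open>x\<^sup>m q\<^sub>t(x)\<close> by the choice of \<open>m\<close>. Hence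
  \<open>q\<^sub>t(t) = 0\<close> for \<open>t \<noteq> 0\<close>, so also for \<open>t = 0\<close>; but \<open>q\<^sub>0(0)\<close> is the coefficient of \<open>h\<close> that was
  chosen nonzero.
\<close>

text \<open>Treating \<open>t\<close> as an indeterminate replaces the passage from nonzero
  \<open>t\<close> to \<open>t = 0\<close> by cancelling a power of \<open>t\<close> in a polynomial
  ring.\<close>

lemma coeff_char_poly_eq_0:
  fixes H H' :: "'a::field_char_0 mat"
  assumes H: "H \<in> carrier_mat n n" and H': "H' \<in> carrier_mat n n"
    and low: "\<And>t k. k < m \<Longrightarrow> coeff (char_poly (H + t \<cdot>\<^sub>m H')) k = 0"
    and root: "\<And>t. poly (char_poly (H + t \<cdot>\<^sub>m H')) t = 0"
  shows "coeff (char_poly H) m = 0"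
proof -
  \<comment> \<open>\<open>M\<close> is \<open>H + t H'\<close> over the polynomials in
    \<open>t\<close>. In \<open>char_poly M\<close> the outer variable is \<open>x\<close>, and the
    coefficients are polynomials in \<open>t\<close>.\<close>
  define M where "M = map_mat (\<lambda>a. [:a:]) H + [:0, 1:] \<cdot>\<^sub>m map_mat (\<lambda>a. [:a:]) H'"
  have M: "M \<in> carrier_mat n n" using H H' by (simp add: M_def)
  have "map_mat (\<lambda>p. poly p t) M = H + t \<cdot>\<^sub>m H'" for t
    using H H' by (intro eq_matI) (auto simp: M_def)
  then have eval: "map_poly (\<lambda>p. poly p t) (char_poly M) = char_poly (H + t \<cdot>\<^sub>m H')" for t
    using poly_hom.char_poly_hom[OF M, of t] by simp
  then have coeff: "poly (coeff (char_poly M) k) t = coeff (char_poly (H + t \<cdot>\<^sub>m H')) k" for k t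
    by (metis coeff_map_poly poly_0)
  \<comment> \<open>A polynomial in \<open>t\<close> that vanishes at every point of an infinite
    field is zero. The factor \<open>D\<close> obtained from this is
    \<open>q\<^sub>t(x)\<close>.\<close>
  have "coeff (char_poly M) k = 0" if "k < m" for k
    using low[OF that] coeff by (metis poly_all_0_iff_0)
  then obtain D where D: "char_poly M = monom 1 m * D"
    by (metis monom_1_dvd_iff' dvdE)
  \<comment> \<open>Evaluating at \<open>[:0, 1:]\<close> substitutes \<open>x = t\<close>.\<close>
  have "poly (poly (char_poly M) [:0, 1:]) t = 0" for t
    using poly_hom.poly_map_poly[of t "char_poly M" "[:0, 1:]"] root[of t] by (simp add: eval)
  then have "poly (char_poly M) [:0, 1:] = 0" using poly_all_0_iff_0 by blast
  \<comment> \<open>The substitution gives \<open>t^m * D(t) = 0\<close>, and polynomials in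
    \<open>t\<close> form an integral domain.\<close>
  then have "poly D [:0, 1:] = 0" by (simp add: D poly_monom)
  then have "poly (map_poly (\<lambda>p. poly p 0) D) 0 = 0"
    using poly_hom.poly_map_poly[of 0 D "[:0, 1:]"] by simp
  then have "poly (coeff D 0) 0 = 0" by (simp add: poly_0_coeff_0 coeff_map_poly)
  moreover have "coeff (char_poly M) m = coeff D 0" by (simp add: D coeff_monom_mult)
  moreover have "H + 0 \<cdot>\<^sub>m H' = H" using H H' by (intro eq_matI) auto
  ultimately show ?thesis using coeff[of m 0] by simp
qed

lemma ex_no_eigenvalue_0:
  fixes S :: "'a::field_char_0 mat set"
  assumes S: "S \<subseteq> carrier_mat n n"
    and closed: "\<And>H H' t. H \<in> S \<Longrightarrow> H' \<in> S \<Longrightarrow> H + t \<cdot>\<^sub>m H' \<in> S"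
    and fixing: "\<And>v. v \<in> carrier_vec n \<Longrightarrow> \<exists>H\<in>S. H *\<^sub>v v = v"
  shows "\<exists>H\<in>S. \<not> eigenvalue H 0"
proof (rule ccontr)
  assume "\<not> ?thesis"
  then have singular: "eigenvalue H 0" if "H \<in> S" for H using that by blast
  define P where "P k \<longleftrightarrow> (\<exists>H\<in>S. coeff (char_poly H) k \<noteq> 0)" for k
  \<comment> \<open>The zero vector serves to show that \<open>S\<close> is nonempty. The
    characteristic polynomial of \<open>G\<close> is monic of degree \<open>n\<close>, so a least
    index \<open>m\<close> exists.\<close>
  obtain G where "G \<in> S" using fixing[of "0\<^sub>v n"] by auto
  moreover from this have "coeff (char_poly G) n = 1" using S degree_monic_char_poly by blast
  ultimately have "P n" unfolding P_def by (intro bexI[of _ G]) simp_all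
  define m where "m = (LEAST k. P k)"
  have "P m" unfolding m_def by (rule LeastI) fact
  then obtain H where HS: "H \<in> S" and nz: "coeff (char_poly H) m \<noteq> 0" by (auto simp: P_def)
  have H: "H \<in> carrier_mat n n" using HS S by auto
  obtain v where v: "v \<in> carrier_vec n" "v \<noteq> 0\<^sub>v n" "H *\<^sub>v v = 0 \<cdot>\<^sub>v v"
    using singular[OF HS] H by (auto simp: eigenvalue_def eigenvector_def)
  obtain H' where H'S: "H' \<in> S" and fix_v: "H' *\<^sub>v v = v" using fixing v by blast
  have H': "H' \<in> carrier_mat n n" using H'S S by auto
  have "coeff (char_poly (H + t \<cdot>\<^sub>m H')) k = 0" if "k < m" for t k
    using not_less_Least[of k P] that closed[OF HS H'S] by (auto simp: m_def P_def)
  moreover have "poly (char_poly (H + t \<cdot>\<^sub>m H')) t = 0" for t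
  proof -
    have "(H + t \<cdot>\<^sub>m H') *\<^sub>v v = H *\<^sub>v v + (t \<cdot>\<^sub>m H') *\<^sub>v v"
      using H H' v by (intro add_mult_distrib_mat_vec) auto
    also have "(t \<cdot>\<^sub>m H') *\<^sub>v v = t \<cdot>\<^sub>v (H' *\<^sub>v v)"
      using H' v by (intro eq_vecI) auto
    also have "H *\<^sub>v v + t \<cdot>\<^sub>v (H' *\<^sub>v v) = t \<cdot>\<^sub>v v"
      using v by (intro eq_vecI) (auto simp: fix_v)
    finally have "eigenvalue (H + t \<cdot>\<^sub>m H') t"
      using v H H' by (auto simp: eigenvalue_def eigenvector_def)
    then show ?thesis using eigenvalue_root_char_poly[of "H + t \<cdot>\<^sub>m H'" n] H H' by simp
  qed
  ultimately show False using coeff_char_poly_eq_0[OF H H'] nz by blast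
qed

context finite_dimensional_vector_space
begin

text \<open>A list of basis vectors is used because matrix indices require an ordering of the
  basis.\<close>

definition coord_vec :: "'b list \<Rightarrow> 'b \<Rightarrow> 'a vec"
  where "coord_vec bs v = vec (length bs) (\<lambda>i. representation (set bs) v (bs ! i))"

definition coord_mat :: "'b list \<Rightarrow> ('b \<Rightarrow> 'b) \<Rightarrow> 'a mat"
  where "coord_mat bs g =
    mat (length bs) (length bs) (\<lambda>(i, j). representation (set bs) (g (bs ! j)) (bs ! i))"

context
  fixes bs :: "'b list"
  assumes dist: "distinct bs" and bs: "set bs = Basis"
begin

lemma sum_nth: "(\<Sum>j<length bs. F (bs ! j)) = sum F Basis"
  using sum.reindex_bij_betw[OF bij_betw_nth[OF dist refl refl], of F] by (simp add: bs)

text \<open>This carries \<open>g v = v\<close> over to a fixed coordinate vector, and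
  \<open>g v = 0\<close> to a vector killed by the matrix.\<close>

lemma coord_mat_mult_coord_vec:
  assumes g: "Vector_Spaces.linear scale scale g"
  shows "coord_mat bs g *\<^sub>v coord_vec bs v = coord_vec bs (g v)"
proof (rule eq_vecI)
  interpret g: Vector_Spaces.linear scale scale g by fact
  fix i assume "i < dim_vec (coord_vec bs (g v))"
  then have i: "i < length bs" by (simp add: coord_vec_def)
  \<comment> \<open>The \<open>i\<close>-th coordinate functional. Its linearity and that of
    \<open>g\<close> reassemble the sum into the basis expansion of \<open>v\<close>.\<close>
  define r where "r w = representation Basis w (bs ! i)" for w
  have "Vector_Spaces.linear scale (*) r"
    unfolding r_def by (rule linear_representation[OF independent_Basis span_Basis])
  then interpret r: Vector_Spaces.linear scale "(*)" r .
  have "(coord_mat bs g *\<^sub>v coord_vec bs v) $ i =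
      (\<Sum>j<length bs. r (g (bs ! j)) * representation Basis v (bs ! j))"
    using i by (simp add: coord_mat_def coord_vec_def scalar_prod_def bs r_def lessThan_atLeast0)
  also have "\<dots> = (\<Sum>b\<in>Basis. r (g b) * representation Basis v b)"
    by (rule sum_nth)
  also have "\<dots> = r (g (\<Sum>b\<in>Basis. representation Basis v b *s b))"
    by (simp add: g.sum g.scale r.sum r.scale mult.commute)
  also have "(\<Sum>b\<in>Basis. representation Basis v b *s b) = v"
    by (rule sum_representation_eq) (auto simp: independent_Basis span_Basis finite_Basis)
  finally show "(coord_mat bs g *\<^sub>v coord_vec bs v) $ i = coord_vec bs (g v) $ i"
    using i by (simp add: coord_vec_def r_def bs)
qed (simp add: coord_mat_def coord_vec_def)

lemma coord_vec_eq_0: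
  assumes "coord_vec bs v = 0\<^sub>v (length bs)"
  shows "v = 0"
proof -
  have "representation Basis v (bs ! i) = 0" if "i < length bs" for i
    using arg_cong[OF assms, of "\<lambda>x. x $ i"] that by (simp add: coord_vec_def bs)
  then have "representation Basis v b = 0" if "b \<in> Basis" for b
    using that by (metis bs in_set_conv_nth)
  then have "(\<Sum>b\<in>Basis. representation Basis v b *s b) = 0" by simp
  then show ?thesis
    using sum_representation_eq[OF independent_Basis, of v Basis]
    by (simp add: span_Basis finite_Basis)
qed

text \<open>The hypothesis \<open>fixing\<close> of \<open>ex_no_eigenvalue_0\<close> ranges over
  all of \<open>carrier_vec n\<close>, so every such vector has to come from some
  \<open>v\<close>.\<close>

lemma coord_vec_surj:
  assumes x: "x \<in> carrier_vec (length bs)"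
  obtains v where "coord_vec bs v = x"
proof
  show "coord_vec bs (\<Sum>j<length bs. x $ j *s bs ! j) = x" (is "coord_vec bs ?v = x")
  proof (rule eq_vecI)
    fix i assume "i < dim_vec x"
    then have i: "i < length bs" using x by simp
    have B: "bs ! j \<in> Basis" if "j < length bs" for j using that bs by auto
    have "representation Basis ?v (bs ! i) =
        (\<Sum>j<length bs. representation Basis (x $ j *s bs ! j) (bs ! i))"
      by (subst representation_sum) (auto simp: independent_Basis span_Basis)
    also have "\<dots> = (\<Sum>j<length bs. if j = i then x $ j else 0)"
      by (intro sum.cong refl)
        (use i B dist in \<open>auto simp: representation_scale representation_basis independent_Basis
          span_Basis nth_eq_iff_index_eq\<close>)
    also have "\<dots> = x $ i" using i by simp
    finally show "coord_vec bs ?v $ i = x $ i" using i by (simp add: coord_vec_def bs)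
  qed (use x in \<open>simp add: coord_vec_def\<close>)
qed

lemma coord_mat_add_scale:
  "coord_mat bs (g + fun_scale scale t h) = coord_mat bs g + t \<cdot>\<^sub>m coord_mat bs h"
  by (intro eq_matI)
    (auto simp: coord_mat_def fun_scale_def bs representation_add representation_scale
      independent_Basis span_Basis)

text \<open>By \<open>coord_vec_eq_0\<close>, a nonzero kernel vector has nonzero coordinates, which
  form an eigenvector of the matrix for 0.\<close>

lemma not_eigenvalue_0_imp_inj:
  assumes g: "Vector_Spaces.linear scale scale g" and ev: "\<not> eigenvalue (coord_mat bs g) 0"
  shows "inj g"
proof -
  interpret g: Vector_Spaces.linear scale scale g by fact
  have "v = 0" if "g v = 0" for v
  proof (rule coord_vec_eq_0, rule ccontr)
    assume nz: "coord_vec bs v \<noteq> 0\<^sub>v (length bs)"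
    have "coord_mat bs g *\<^sub>v coord_vec bs v = coord_vec bs 0"
      by (simp only: coord_mat_mult_coord_vec[OF g] that)
    also have "\<dots> = 0 \<cdot>\<^sub>v coord_vec bs v"
      by (intro eq_vecI) (auto simp: coord_vec_def representation_zero)
    finally have "coord_mat bs g *\<^sub>v coord_vec bs v = 0 \<cdot>\<^sub>v coord_vec bs v" .
    then show False
      using ev nz unfolding eigenvalue_def eigenvector_def
      by (metis (no_types, lifting) coord_mat_def coord_vec_def dim_row_mat(1) vec_carrier)
  qed
  then show ?thesis using g.inj_iff_eq_0 by blast
qed

end

end

lemma ex_inj_if_locally_fixing:
  fixes s :: "'a::field_char_0 \<Rightarrow> 'v::ab_group_add \<Rightarrow> 'v"
  assumes "finite_dimensional_vector_space s B"
    and E: "E \<subseteq> End s"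
    and closed: "\<And>g h t. g \<in> E \<Longrightarrow> h \<in> E \<Longrightarrow> g + fun_scale s t h \<in> E"
    and fixing: "\<And>v. \<exists>g\<in>E. g v = v"
  shows "\<exists>g\<in>E. inj g"
proof -
  interpret finite_dimensional_vector_space s B by fact
  obtain bs where bs: "set bs = B" "distinct bs"
    using finite_distinct_list[OF finite_Basis] by blast
  have lin: "Vector_Spaces.linear s s g" if "g \<in> E" for g using that E by (auto simp: End_def)
  have "\<exists>H\<in>coord_mat bs ` E. \<not> eigenvalue H 0"
  proof (rule ex_no_eigenvalue_0)
    show "coord_mat bs ` E \<subseteq> carrier_mat (length bs) (length bs)"
      by (auto simp: coord_mat_def)
    show "H + t \<cdot>\<^sub>m H' \<in> coord_mat bs ` E"
      if "H \<in> coord_mat bs ` E" "H' \<in> coord_mat bs ` E" for H H' t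
      using that closed by (auto simp: coord_mat_add_scale[OF bs(2,1), symmetric])
    fix x :: "'a vec" assume "x \<in> carrier_vec (length bs)"
    then obtain v where v: "coord_vec bs v = x" using coord_vec_surj[OF bs(2,1)] by blast
    obtain g where "g \<in> E" "g v = v" using fixing by blast
    then show "\<exists>H\<in>coord_mat bs ` E. H *\<^sub>v x = x"
      using coord_mat_mult_coord_vec[OF bs(2,1) lin] v by (metis image_eqI)
  qed
  then show ?thesis using not_eigenvalue_0_imp_inj[OF bs(2,1) lin] by blast
qed

theorem theorem2p17:
  fixes s :: "complex \<Rightarrow> 'v::ab_group_add \<Rightarrow> 'v"
    and B :: "'v set"
    and E :: "('v \<Rightarrow> 'v) set"
  assumes "finite_dimensional_vector_space s B"
    and "E \<subseteq> End s"
    and "module.subspace (fun_scale s) E"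
    and "Ref_a s E \<inter> GL s \<noteq> {}"
  shows "E \<inter> GL s \<noteq> {}"
proof -
  interpret V: finite_dimensional_vector_space s B by fact
  interpret F: vector_space "fun_scale s"
    by (rule vector_space_fun_scale) (rule V.vector_space_axioms)
  obtain f where f: "Vector_Spaces.linear s s f" "bij f" and loc: "\<And>v. \<exists>g\<in>E. f v = g v"
    using assms(4) by (fastforce simp: Ref_a_def GL_def End_def eval_at_def)
  interpret f: Vector_Spaces.linear s s f by fact
  define k where "k = inv_into UNIV f"
  have kf: "k \<circ> f = id" using f(2) by (simp add: k_def bij_is_inj)
  have fk: "f (k w) = w" for w using f(2) by (simp add: k_def bij_is_surj surj_f_inv_f)
  \<comment> \<open>Linearity of the inverse: both sides agree after applying the injective map
    \<open>f\<close>.\<close>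
  have "k (v + w) = k v + k w" "k (s t v) = s t (k v)" for t v w
    by (rule injD[OF bij_is_inj[OF f(2)]], simp add: f.add f.scale fk)+
  then have k: "Vector_Spaces.linear s s k"
    by (simp add: Vector_Spaces.linear_iff V.vector_space_axioms)
  interpret k: Vector_Spaces.linear s s k by fact
  have lin: "Vector_Spaces.linear s s g" if "g \<in> E" for g
    using that assms(2) by (auto simp: End_def)
  have "\<exists>g\<in>(\<circ>) k ` E. inj g"
  proof (rule ex_inj_if_locally_fixing[OF assms(1)])
    show "(\<circ>) k ` E \<subseteq> End s"
      using lin k by (auto simp: End_def intro: Vector_Spaces.linear_compose)
    show "g + fun_scale s t h \<in> (\<circ>) k ` E" if gh: "g \<in> (\<circ>) k ` E" "h \<in> (\<circ>) k ` E" for g h t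
    proof -
      obtain g' h' where g': "g' \<in> E" "g = k \<circ> g'" and h': "h' \<in> E" "h = k \<circ> h'"
        using gh by blast
      have "g + fun_scale s t h = k \<circ> (g' + fun_scale s t h')"
        by (simp add: g' h' fun_eq_iff fun_scale_def k.add k.scale)
      moreover have "g' + fun_scale s t h' \<in> E"
        using g' h' assms(3) F.subspace_add F.subspace_scale by blast
      ultimately show ?thesis by blast
    qed
    \<comment> \<open>If \<open>g\<close> in \<open>E\<close> agrees with \<open>f\<close> at
      \<open>v\<close>, then \<open>k (g v) = k (f v) = v\<close>.\<close>
    show "\<exists>g\<in>(\<circ>) k ` E. g v = v" for v
      using loc[of v] kf by (metis comp_apply id_apply image_eqI)
  qed
  then obtain g where g: "g \<in> E" "inj (k \<circ> g)" by blast
  \<comment> \<open>Injectivity of a composition passes to the map applied first. Finite dimension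
    then yields surjectivity.\<close>
  then have "inj g" using inj_on_imageI2 by blast
  then have "bij g" using V.linear_inj_imp_surj[OF lin[OF g(1)]] by (simp add: bij_def)
  then show ?thesis using g assms(2) by (auto simp: GL_def)
qed

end
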